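(* Let $k$ be a positive integer and let $G$ be a finite tree with at least one edge. If $s(G)\leq k$, then $G$ is isomorphic to a subgraph (not necessarily induced) of the hyperdiamond graph $H_k$.
   Context: A vertex labeling of a graph $G$ is an injective map $f:V(G)\to\mathbb{Z}$. It induces the edge labeling $f^+:E(G)\to\mathbb{Z}$, $f^+(uv)=f(u)+f(v)$, and $|f^+|$ denotes the number of distinct values $f^+$ takes on $E(G)$. The sum index $s(G)$ is the minimum positive integer $k$ such that there exists a vertex labeling $f$ of $G$ with $|f^+|=k$. Let $\mathbf{e}_1,\dotsc,\mathbf{e}_k$ be the standard basis vectors of $\mathbb{Z}^k$. For $i=1,\dotsc,k$, define $\psi_i:\mathbb{Z}^k\to\mathbb{Z}^k$ by $\psi_i(\mathbf{x})=\mathbf{e}_i-\mathbf{x}$. The hyperdiamond group $\Gamma_k$ is the group generated by $\psi_1,\dotsc,\psi_k$ under composition. The hyperdiamond graph $H_k$ is the Cayley graph of $\Gamma_k$ with generating set $S=\{\psi_1,\dotsc,\psi_k\}$: its vertex set is $\Gamma_k$, and $\phi,\phi'\in\Gamma_k$ are adjacent if and only if $\phi\circ(\phi')^{-1}\in S$. Since $\psi_i^{-1}=\psi_i$ for all $i$, $H_k$ is an undirected graph. *)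

theory Defs
  imports "HOL-Algebra.Bij" "HOL-Algebra.Generated_Groups" "Graph_Theory.Graph_Theory"
begin

text \<open>
  A finite simple graph is a \<^locale>\<open>pair_graph\<close>: an edge \<open>uv\<close> is the pair of opposite arcs
  \<open>(u, v)\<close>, \<open>(v, u)\<close>. In this encoding \<open>u, v, u\<close> counts as a \<^const>\<open>pre_digraph.cycle\<close> for every
  edge \<open>uv\<close>, so that \<^const>\<open>tree\<close> fails as soon as there is an edge. The cycles of the undirected
  graph are those of length at least 3.
\<close>

definition undirected_tree :: "'a pair_pre_digraph \<Rightarrow> bool" where
  "undirected_tree G \<longleftrightarrow>
     connected (with_proj G) \<and> \<not> (\<exists>p. pre_digraph.cycle (with_proj G) p \<and> 3 \<le> length p)"

definition vertex_labeling :: "'a pair_pre_digraph \<Rightarrow> ('a \<Rightarrow> int) \<Rightarrow> bool" where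
  "vertex_labeling G f \<longleftrightarrow> inj_on f (pverts G)"

definition edge_labels :: "'a pair_pre_digraph \<Rightarrow> ('a \<Rightarrow> int) \<Rightarrow> int set" where
  "edge_labels G f = (\<lambda>(u, v). f u + f v) ` parcs G"

text \<open>Only meaningful for graphs with an edge; otherwise no positive \<open>k\<close> qualifies.\<close>

definition sum_index :: "'a pair_pre_digraph \<Rightarrow> nat" where
  "sum_index G = (LEAST k. 0 < k \<and> (\<exists>f. vertex_labeling G f \<and> card (edge_labels G f) = k))"

text \<open>\<open>\<int>\<^sup>k\<close>, with coordinates indexed by \<open>1, \<dots>, k\<close>.\<close>

definition int_vecs :: "nat \<Rightarrow> (nat \<Rightarrow> int) set" where
  "int_vecs k = {1..k} \<rightarrow>\<^sub>E UNIV"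

definition std_basis :: "nat \<Rightarrow> nat \<Rightarrow> nat \<Rightarrow> int" where
  "std_basis k i = (\<lambda>j\<in>{1..k}. if j = i then 1 else 0)"

definition psi :: "nat \<Rightarrow> nat \<Rightarrow> (nat \<Rightarrow> int) \<Rightarrow> (nat \<Rightarrow> int)" where
  "psi k i = (\<lambda>x\<in>int_vecs k. \<lambda>j\<in>{1..k}. std_basis k i j - x j)"

definition hyperdiamond_gens :: "nat \<Rightarrow> ((nat \<Rightarrow> int) \<Rightarrow> (nat \<Rightarrow> int)) set" where
  "hyperdiamond_gens k = psi k ` {1..k}"

definition hyperdiamond_group :: "nat \<Rightarrow> ((nat \<Rightarrow> int) \<Rightarrow> (nat \<Rightarrow> int)) monoid" where
  "hyperdiamond_group k = subgroup_generated (BijGroup (int_vecs k)) (hyperdiamond_gens k)"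

definition cayley_graph :: "('g, 'm) monoid_scheme \<Rightarrow> 'g set \<Rightarrow> 'g pair_pre_digraph" where
  "cayley_graph \<Gamma> S =
     \<lparr>pverts = carrier \<Gamma>,
      parcs = {(a, b). a \<in> carrier \<Gamma> \<and> b \<in> carrier \<Gamma> \<and> a \<otimes>\<^bsub>\<Gamma>\<^esub> inv\<^bsub>\<Gamma>\<^esub> b \<in> S}\<rparr>"

definition hyperdiamond_graph :: "nat \<Rightarrow> ((nat \<Rightarrow> int) \<Rightarrow> (nat \<Rightarrow> int)) pair_pre_digraph" where
  "hyperdiamond_graph k = cayley_graph (hyperdiamond_group k) (hyperdiamond_gens k)"

lemma sum_index_attained:
  assumes "pair_graph G" "parcs G \<noteq> {}"
  shows "0 < sum_index G \<and> (\<exists>f. vertex_labeling G f \<and> card (edge_labels G f) = sum_index G)"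
proof -
  interpret pair_graph G by fact
  obtain g :: "'a \<Rightarrow> nat" where g: "inj_on g (pverts G)"
    using finite_imp_inj_to_nat_seg[OF pair_finite_verts] by blast
  let ?f = "int \<circ> g"
  have "vertex_labeling G ?f"
    using g by (auto simp: vertex_labeling_def inj_on_def)
  moreover have "0 < card (edge_labels G ?f)"
    using assms(2) pair_finite_arcs by (auto simp: edge_labels_def card_gt_0_iff)
  ultimately show ?thesis
    unfolding sum_index_def
    by (intro LeastI[of "\<lambda>k. 0 < k \<and> (\<exists>f. vertex_labeling G f \<and> card (edge_labels G f) = k)"
          "card (edge_labels G ?f)"]) blast
qed

lemma psi_in_vecs: "x \<in> int_vecs k \<Longrightarrow> psi k i x \<in> int_vecs k"
  by (auto simp: psi_def int_vecs_def)

lemma psi_psi: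
  assumes "x \<in> int_vecs k"
  shows "psi k i (psi k i x) = x"
proof
  fix j
  show "psi k i (psi k i x) j = x j"
    using assms psi_in_vecs[OF assms, of i]
    by (cases "j \<in> {1..k}") (auto simp: psi_def int_vecs_def PiE_def extensional_def)
qed

lemma psi_in_Bij: "psi k i \<in> Bij (int_vecs k)"
proof -
  have "bij_betw (psi k i) (int_vecs k) (int_vecs k)"
    by (rule bij_betw_byWitness[where f' = "psi k i"]) (auto simp: psi_psi psi_in_vecs)
  then show ?thesis by (auto simp: Bij_def psi_def)
qed

lemma psi_neq_id: "i \<in> {1..k} \<Longrightarrow> psi k i \<noteq> (\<lambda>x\<in>int_vecs k. x)"
proof
  assume i: "i \<in> {1..k}" and eq: "psi k i = (\<lambda>x\<in>int_vecs k. x)"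
  let ?z = "\<lambda>j\<in>{1..k}. 0 :: int"
  have z: "?z \<in> int_vecs k" by (auto simp: int_vecs_def)
  then have "psi k i ?z i = ?z i" by (simp add: eq)
  then show False using i z by (simp add: psi_def std_basis_def)
qed

lemma hyperdiamond_gens_subset: "hyperdiamond_gens k \<subseteq> carrier (BijGroup (int_vecs k))"
  by (auto simp: hyperdiamond_gens_def BijGroup_def psi_in_Bij)

lemma group_hyperdiamond_group: "group (hyperdiamond_group k)"
  unfolding hyperdiamond_group_def by (rule group.group_subgroup_generated[OF group_BijGroup])

lemma hyperdiamond_gens_carrier: "hyperdiamond_gens k \<subseteq> carrier (hyperdiamond_group k)"
  unfolding hyperdiamond_group_def
  by (rule group.subgroup_generated_subset_carrier_subset
        [OF group_BijGroup hyperdiamond_gens_subset])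

lemma one_hyperdiamond_group: "\<one>\<^bsub>hyperdiamond_group k\<^esub> = (\<lambda>x\<in>int_vecs k. x)"
  by (simp add: hyperdiamond_group_def subgroup_generated_def BijGroup_def)

lemma hyperdiamond_gens_involution:
  assumes "s \<in> hyperdiamond_gens k"
  shows "inv\<^bsub>hyperdiamond_group k\<^esub> s = s"
proof -
  interpret group "hyperdiamond_group k" by (rule group_hyperdiamond_group)
  obtain i where i: "i \<in> {1..k}" "s = psi k i"
    using assms by (auto simp: hyperdiamond_gens_def)
  have "s \<otimes>\<^bsub>hyperdiamond_group k\<^esub> s = \<one>\<^bsub>hyperdiamond_group k\<^esub>"
    unfolding one_hyperdiamond_group i(2)
    by (simp add: hyperdiamond_group_def subgroup_generated_def BijGroup_def psi_in_Bij
        compose_def psi_psi cong: restrict_cong)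
  then show ?thesis
    using assms hyperdiamond_gens_carrier by (intro inv_equality) auto
qed

lemma pair_bidirected_hyperdiamond_graph: "pair_bidirected_digraph (hyperdiamond_graph k)"
proof -
  interpret group "hyperdiamond_group k" by (rule group_hyperdiamond_group)
  have swap: "b \<otimes>\<^bsub>hyperdiamond_group k\<^esub> inv\<^bsub>hyperdiamond_group k\<^esub> a \<in> hyperdiamond_gens k"
    if "a \<in> carrier (hyperdiamond_group k)" "b \<in> carrier (hyperdiamond_group k)"
      and s: "a \<otimes>\<^bsub>hyperdiamond_group k\<^esub> inv\<^bsub>hyperdiamond_group k\<^esub> b \<in> hyperdiamond_gens k" for a b
    using hyperdiamond_gens_involution[OF s] that by (simp add: inv_mult_group)
  have noloop: "\<one>\<^bsub>hyperdiamond_group k\<^esub> \<notin> hyperdiamond_gens k"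
    unfolding one_hyperdiamond_group hyperdiamond_gens_def
    by (metis imageE psi_neq_id)
  show ?thesis
    by unfold_locales
      (use swap noloop in \<open>auto simp: hyperdiamond_graph_def cayley_graph_def symmetric_def intro!: symI\<close>)
qed

end

theory Submission
  imports Defs
begin

text \<open>
  Let \<open>f\<close> be a labeling of the tree with at most \<open>k\<close> edge labels. Adding a constant to all vertex
  labels shifts all edge labels by twice that constant, so some root \<open>r\<close> may be assumed to have
  label \<open>0\<close>. List the edge labels as \<open>a\<^sub>1, \<dots>, a\<^sub>k\<close> (with repetitions if there are fewer than \<open>k\<close>),
  and let \<open>L(x) = \<Sum>\<^sub>i a\<^sub>i x\<^sub>i\<close> (\<open>weight\<close>). Then \<open>L(\<psi>\<^sub>i(x)) = a\<^sub>i - L(x)\<close>: the functional \<open>L\<close> turns the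
  generator \<open>\<psi>\<^sub>i\<close> into the reflection of \<open>\<int>\<close> that exchanges the labels of the two ends of any edge
  labeled \<open>a\<^sub>i\<close>.

  Send the root to the identity, and whenever \<open>v\<close> is reached from \<open>u\<close> through an edge labeled \<open>a\<^sub>i\<close>,
  send \<open>v\<close> to \<open>\<phi>\<^sub>v = \<psi>\<^sub>i \<circ> \<phi>\<^sub>u\<close>. In a tree each new vertex is reached from exactly one old one, so
  these choices never conflict (\<open>tree_lift\<close>), and adjacent vertices go to adjacent group elements.
  By construction \<open>L(\<phi>\<^sub>v(0)) = f(v)\<close> throughout (\<open>hyperdiamond_lift_step\<close>). Hence \<open>\<phi>\<^sub>v\<close> determines
  \<open>f(v)\<close>, and \<open>v \<mapsto> \<phi>\<^sub>v\<close> is injective because \<open>f\<close> is.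
\<close>

lemma pawalk_verts_snoc:
  "pcas u p x \<Longrightarrow> pawalk_verts u (p @ [(x, v)]) = pawalk_verts u p @ [v]"
  by (induction p arbitrary: u) auto

text \<open>
  A vertex \<open>v\<close> outside a path-connected set \<open>W\<close> has at most one neighbour in \<open>W\<close>: a path in \<open>W\<close>
  between two neighbours would close up to a cycle through \<open>v\<close>. So a tree can be grown from any
  vertex by attaching leaves, and connectedness ensures that the growth stops only at the whole tree.
\<close>

lemma tree_growth_induct [consumes 3, case_names root leaf]:
  fixes G :: "'a pair_pre_digraph"
  assumes G: "pair_graph G" and tree: "undirected_tree G" and r: "r \<in> pverts G"
    and root: "P {r}"
    and leaf: "\<And>W u v. W \<subseteq> pverts G \<Longrightarrow> P W \<Longrightarrow> u \<in> W \<Longrightarrow> v \<in> pverts G - W \<Longrightarrow>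
      (u, v) \<in> parcs G \<Longrightarrow> (\<And>u'. u' \<in> W \<Longrightarrow> (u', v) \<in> parcs G \<Longrightarrow> u' = u) \<Longrightarrow> P (insert v W)"
  shows "P (pverts G)"
proof -
  interpret pair_graph G by fact
  define joined where "joined W \<longleftrightarrow>
    (\<forall>u\<in>W. \<forall>v\<in>W. \<exists>p. apath u p v \<and> set (awalk_verts u p) \<subseteq> W)" for W
  \<comment> \<open>The stages of the growth; a maximal one will turn out to contain every vertex.\<close>
  define F where "F = {W. r \<in> W \<and> W \<subseteq> pverts G \<and> joined W \<and> P W}"
  have "finite F"
    by (rule finite_subset[of _ "Pow (pverts G)"]) (auto simp: F_def pair_finite_verts)
  moreover have "{r} \<in> F"
    using r root by (auto simp: F_def joined_def apath_Nil_iff intro!: exI[of _ "[]"])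
  ultimately obtain W where W: "W \<in> F" and max: "\<And>W'. W' \<in> F \<Longrightarrow> W \<subseteq> W' \<Longrightarrow> W' = W"
    using finite_has_maximal[of F] by blast
  have rW: "r \<in> W" and WV: "W \<subseteq> pverts G" and jW: "joined W" and PW: "P W"
    using W by (auto simp: F_def)
  have "pverts G \<subseteq> W"
  proof (rule ccontr)
    assume "\<not> pverts G \<subseteq> W"
    then obtain w where w: "w \<in> pverts G" "w \<notin> W" by blast
    have symm: "mk_symmetric (with_proj G) = G"
      by (rule pair_pre_digraph.equality) (auto simp: mk_symmetric_def arcs_symmetric)
    have "r \<rightarrow>\<^sup>*\<^bsub>with_proj G\<^esub> w"
      using tree r w by (auto simp: undirected_tree_def connected_def symm strongly_connected_def)
    then have "\<exists>u\<in>W. \<exists>v\<in>pverts G - W. (u, v) \<in> parcs G"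
      using w(2)
    proof (induction rule: reachable_induct)
      case base
      then show ?case using rW by simp
    next
      case (step x y)
      then show ?case by (metis DiffI in_arcsD2)
    qed
    then obtain u v where u: "u \<in> W" and v: "v \<in> pverts G" "v \<notin> W" and uv: "(u, v) \<in> parcs G"
      by blast
    have unique: "u' = u" if u': "u' \<in> W" "(u', v) \<in> parcs G" for u'
    proof (rule ccontr)
      assume "u' \<noteq> u"
      obtain p where p: "apath u p u'" "set (awalk_verts u p) \<subseteq> W"
        using jW u u' unfolding joined_def by blast
      have "p \<noteq> []" using p(1) \<open>u' \<noteq> u\<close> by (auto simp: apath_Nil_iff)
      let ?c = "(v, u) # p @ [(u', v)]"
      have walk: "awalk u (p @ [(u', v)]) v"
        using p u' v by (auto simp: apath_def awalk_simps)
      then have "awalk v ?c v"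
        using arcs_symmetric[OF uv] by (auto simp: awalk_Cons_iff)
      moreover have "awalk_verts u (p @ [(u', v)]) = awalk_verts u p @ [v]"
        using p by (intro pawalk_verts_snoc) (simp add: apath_def awalk_def)
      then have "distinct (tl (awalk_verts v ?c))"
        using p v by (auto simp: apath_def)
      ultimately have "cycle ?c" by (auto simp: cycle_def)
      moreover have "3 \<le> length ?c" using \<open>p \<noteq> []\<close> by (cases p) auto
      ultimately show False using tree unfolding undirected_tree_def by blast
    qed
    have to_v: "\<exists>p. apath x p v \<and> set (awalk_verts x p) \<subseteq> insert v W" if x: "x \<in> W" for x
    proof -
      obtain p where p: "apath x p u" "set (awalk_verts x p) \<subseteq> W"
        using jW u x unfolding joined_def by blast
      have walk: "awalk x (p @ [(u, v)]) v"
        using p uv v by (auto simp: apath_def awalk_simps)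
      have "awalk_verts x (p @ [(u, v)]) = awalk_verts x p @ [v]"
        using p by (intro pawalk_verts_snoc) (simp add: apath_def awalk_def)
      then show ?thesis
        using p v walk by (intro exI[of _ "p @ [(u, v)]"]) (auto simp: apath_def)
    qed
    have from_v: "\<exists>p. apath v p x \<and> set (awalk_verts v p) \<subseteq> insert v W" if x: "x \<in> W" for x
    proof -
      obtain p where p: "apath x p v" "set (awalk_verts x p) \<subseteq> insert v W"
        using to_v[OF x] by blast
      then have "awalk_verts v (rev_path p) = rev (awalk_verts x p)"
        by (intro awalk_verts_rev_path) (simp add: apath_def)
      then show ?thesis
        using p by (intro exI[of _ "rev_path p"]) simp
    qed
    have within_W: "\<exists>p. apath x p y \<and> set (awalk_verts x p) \<subseteq> insert v W"
      if "x \<in> W" "y \<in> W" for x y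
      using jW that unfolding joined_def by blast
    have "\<exists>p. apath v p v \<and> set (awalk_verts v p) \<subseteq> insert v W"
      using v by (intro exI[of _ "[]"]) (simp add: apath_Nil_iff)
    then have "joined (insert v W)"
      using to_v from_v within_W unfolding joined_def by simp
    moreover have "P (insert v W)"
      using leaf[OF WV PW u _ uv unique] v by blast
    ultimately have "insert v W \<in> F" using rW WV v by (auto simp: F_def)
    then show False using max[of "insert v W"] v by auto
  qed
  then show ?thesis using WV PW by (simp add: subset_antisym)
qed

text \<open>
  Here \<open>Q v\<close> is a fibre of possible values over each vertex and \<open>R\<close> a symmetric relation between
  fibres over adjacent vertices. If related values can be chosen along each single edge, they can be
  chosen coherently on a tree, since a leaf imposes only one condition on its value.
\<close>

lemma tree_lift:
  fixes G :: "'a pair_pre_digraph" and Q :: "'a \<Rightarrow> 'b \<Rightarrow> bool" and R :: "'b \<Rightarrow> 'b \<Rightarrow> bool"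
  assumes G: "pair_graph G" and tree: "undirected_tree G" and r: "r \<in> pverts G"
    and start: "Q r x\<^sub>0"
    and sym: "\<And>x y. R x y \<Longrightarrow> R y x"
    and step: "\<And>u v x. (u, v) \<in> parcs G \<Longrightarrow> Q u x \<Longrightarrow> \<exists>y. Q v y \<and> R x y"
  shows "\<exists>\<phi>. (\<forall>v\<in>pverts G. Q v (\<phi> v)) \<and> (\<forall>(u, v)\<in>parcs G. R (\<phi> u) (\<phi> v))"
proof -
  interpret pair_graph G by fact
  have "\<exists>\<phi>. (\<forall>v\<in>pverts G. Q v (\<phi> v)) \<and>
    (\<forall>u\<in>pverts G. \<forall>v\<in>pverts G. (u, v) \<in> parcs G \<longrightarrow> R (\<phi> u) (\<phi> v))"
    using G tree r
  proof (induction rule: tree_growth_induct)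
    case root
    show ?case using start no_loops' by (intro exI[of _ "\<lambda>_. x\<^sub>0"]) auto
  next
    case (leaf W u v)
    then obtain \<phi> where \<phi>: "\<forall>v\<in>W. Q v (\<phi> v)"
      "\<forall>u\<in>W. \<forall>v\<in>W. (u, v) \<in> parcs G \<longrightarrow> R (\<phi> u) (\<phi> v)" by blast
    obtain y where y: "Q v y" "R (\<phi> u) y" using step leaf \<phi> by blast
    have "R (\<phi> u') y" if "u' \<in> W" "(u', v) \<in> parcs G" for u'
      using leaf.hyps(5)[OF that] y by blast
    then have "R ((\<phi>(v := y)) u') ((\<phi>(v := y)) v')"
      if "u' \<in> insert v W" "v' \<in> insert v W" "(u', v') \<in> parcs G" for u' v'
      using that \<phi>(2) sym arcs_symmetric[OF that(3)] no_loops'[OF that(3)] by auto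
    then show ?case
      using \<phi>(1) y(1) by (intro exI[of _ "\<phi>(v := y)"]) auto
  qed
  then show ?thesis using in_arcsD1 in_arcsD2 by blast
qed

definition weight :: "nat \<Rightarrow> (nat \<Rightarrow> int) \<Rightarrow> (nat \<Rightarrow> int) \<Rightarrow> int" where
  "weight k a x = (\<Sum>i\<in>{1..k}. a i * x i)"

definition zero_vec :: "nat \<Rightarrow> nat \<Rightarrow> int" where
  "zero_vec k = (\<lambda>j\<in>{1..k}. 0)"

lemma zero_vec_in_vecs: "zero_vec k \<in> int_vecs k"
  by (auto simp: zero_vec_def int_vecs_def)

lemma weight_zero_vec: "weight k a (zero_vec k) = 0"
  by (simp add: weight_def zero_vec_def)

lemma weight_psi:
  assumes "i \<in> {1..k}" "x \<in> int_vecs k"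
  shows "weight k a (psi k i x) = a i - weight k a x"
proof -
  have "weight k a (psi k i x) = (\<Sum>j\<in>{1..k}. (if j = i then a i else 0) - a j * x j)"
    unfolding weight_def
    by (rule sum.cong) (use assms in \<open>auto simp: psi_def std_basis_def algebra_simps\<close>)
  then show ?thesis
    using assms by (simp add: sum_subtractf weight_def)
qed

lemma hyperdiamond_group_in_Bij:
  "x \<in> carrier (hyperdiamond_group k) \<Longrightarrow> x \<in> Bij (int_vecs k)"
  using group.carrier_subgroup_generated_subset[OF group_BijGroup, of "int_vecs k"]
  by (auto simp: hyperdiamond_group_def BijGroup_def)

text \<open>
  Crossing an edge labeled \<open>s + t\<close> in the tree can be matched by a step in the hyperdiamond graph that
  takes the weight of the image of the origin from \<open>s\<close> to \<open>t\<close>.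
\<close>

lemma hyperdiamond_lift_step:
  assumes x: "x \<in> carrier (hyperdiamond_group k)" and i: "i \<in> {1..k}"
    and s: "weight k a (x (zero_vec k)) = s" and "a i = s + t"
  shows "\<exists>y. weight k a (y (zero_vec k)) = t \<and> (x, y) \<in> parcs (hyperdiamond_graph k)"
proof -
  interpret group "hyperdiamond_group k" by (rule group_hyperdiamond_group)
  interpret H: pair_bidirected_digraph "hyperdiamond_graph k"
    by (rule pair_bidirected_hyperdiamond_graph)
  have gen: "psi k i \<in> hyperdiamond_gens k" using i by (simp add: hyperdiamond_gens_def)
  then have psi: "psi k i \<in> carrier (hyperdiamond_group k)"
    using hyperdiamond_gens_carrier by blast
  define y where "y = psi k i \<otimes>\<^bsub>hyperdiamond_group k\<^esub> x"
  have "y \<in> carrier (hyperdiamond_group k)" using x psi by (simp add: y_def)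
  moreover have "y \<otimes>\<^bsub>hyperdiamond_group k\<^esub> inv\<^bsub>hyperdiamond_group k\<^esub> x = psi k i"
    using x psi by (simp add: y_def m_assoc)
  ultimately have "(y, x) \<in> parcs (hyperdiamond_graph k)"
    using x gen by (simp add: hyperdiamond_graph_def cayley_graph_def)
  then have "(x, y) \<in> parcs (hyperdiamond_graph k)" by (rule H.arcs_symmetric)
  moreover have "x (zero_vec k) \<in> int_vecs k"
    using hyperdiamond_group_in_Bij[OF x] zero_vec_in_vecs
    by (auto simp: Bij_def dest: bij_betwE)
  then have "weight k a (psi k i (x (zero_vec k))) = t"
    using assms weight_psi[OF i] by simp
  moreover have "y (zero_vec k) = psi k i (x (zero_vec k))"
    using hyperdiamond_group_in_Bij[OF x] psi_in_Bij zero_vec_in_vecs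
    by (simp add: y_def hyperdiamond_group_def BijGroup_def compose_def)
  ultimately show ?thesis by (intro exI[of _ y]) simp
qed

lemma injective_hom_imp_subgraph_iso:
  fixes G :: "'a pair_pre_digraph" and K :: "'b pair_pre_digraph"
  assumes G: "pair_wf_digraph G" and K: "pair_wf_digraph K"
    and inj: "inj_on \<phi> (pverts G)"
    and verts: "\<phi> ` pverts G \<subseteq> pverts K"
    and arcs: "\<forall>(u, v)\<in>parcs G. (\<phi> u, \<phi> v) \<in> parcs K"
  shows "\<exists>H. subgraph (with_proj H) (with_proj K) \<and> digraph_iso (with_proj G) (with_proj H)"
proof -
  interpret G: pair_wf_digraph G by fact
  define H where "H = \<lparr>pverts = \<phi> ` pverts G, parcs = map_prod \<phi> \<phi> ` parcs G\<rparr>"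
  define h where "h = \<lparr>iso_verts = \<phi>, iso_arcs = map_prod \<phi> \<phi>, iso_head = snd, iso_tail = fst\<rparr>"
  have "pair_wf_digraph H"
    by unfold_locales (auto simp: H_def G.in_arcsD1 G.in_arcsD2)
  then have "subgraph (with_proj H) (with_proj K)"
    using K verts arcs by (auto simp: subgraph_def wf_digraph_wp_iff H_def)
  moreover have "inj_on (map_prod \<phi> \<phi>) (parcs G)"
    by (rule inj_on_subset[OF map_prod_inj_on[OF inj inj]]) (auto simp: G.in_arcsD1 G.in_arcsD2)
  then have "pre_digraph.digraph_isomorphism (with_proj G) h"
    using inj G by (auto simp: pre_digraph.digraph_isomorphism_def h_def wf_digraph_wp_iff)
  moreover have "with_proj H = app_iso h (with_proj G)"
    by (simp add: with_proj_def app_iso_def H_def h_def)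
  ultimately show ?thesis unfolding digraph_iso_def by blast
qed

theorem theorem2p22:
  fixes k :: nat and G :: "'a pair_pre_digraph"
  assumes "0 < k"
    and "pair_graph G"
    and "undirected_tree G"
    and "parcs G \<noteq> {}"
    and "sum_index G \<le> k"
  shows "\<exists>H. subgraph (with_proj H) (with_proj (hyperdiamond_graph k)) \<and>
             digraph_iso (with_proj G) (with_proj H)"
proof -
  interpret pair_graph G by fact
  interpret K: pair_bidirected_digraph "hyperdiamond_graph k"
    by (rule pair_bidirected_hyperdiamond_graph)
  obtain r where r: "r \<in> pverts G"
    using assms(4) arc_fst_in_verts by blast
  obtain f where inj: "inj_on f (pverts G)" and "card (edge_labels G f) \<le> k"
    using sum_index_attained[OF assms(2,4)] assms(5) by (auto simp: vertex_labeling_def)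
  moreover have "finite (edge_labels G f)" "edge_labels G f \<noteq> {}"
    using assms(4) pair_finite_arcs by (auto simp: edge_labels_def)
  ultimately obtain b where b: "edge_labels G f \<subseteq> b ` {1..k}"
    using card_le_inj[of "edge_labels G f" "{1..k}"]
      inj_on_iff_surj[of "edge_labels G f" "{1..k}"] by auto
  define g where "g v = f v - f r" for v
  \<comment> \<open>Lowering every vertex label by \<open>f r\<close> lowers every edge label by \<open>2 * f r\<close>.\<close>
  define a where "a i = b i - 2 * f r" for i
  define Q where "Q v x \<longleftrightarrow> x \<in> carrier (hyperdiamond_group k) \<and>
    weight k a (x (zero_vec k)) = g v" for v x
  have "\<exists>\<phi>. (\<forall>v\<in>pverts G. Q v (\<phi> v)) \<and>
    (\<forall>(u, v)\<in>parcs G. (\<phi> u, \<phi> v) \<in> parcs (hyperdiamond_graph k))"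
  proof (rule tree_lift[OF assms(2,3) r])
    show "Q r (\<one>\<^bsub>hyperdiamond_group k\<^esub>)"
      using group.is_monoid[OF group_hyperdiamond_group] zero_vec_in_vecs
      by (auto simp: Q_def g_def one_hyperdiamond_group[symmetric] monoid.one_closed)
        (simp add: one_hyperdiamond_group weight_zero_vec)
  next
    fix u v x assume uv: "(u, v) \<in> parcs G" and x: "Q u x"
    have "f u + f v \<in> edge_labels G f" using uv by (auto simp: edge_labels_def)
    then obtain i where i: "i \<in> {1..k}" "b i = f u + f v" using b by (metis imageE subsetD)
    then have "a i = g u + g v" by (simp add: a_def g_def)
    then obtain y where "weight k a (y (zero_vec k)) = g v"
      and "(x, y) \<in> parcs (hyperdiamond_graph k)"
      using hyperdiamond_lift_step[of x k i a "g u" "g v"] x i by (auto simp: Q_def)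
    then show "\<exists>y. Q v y \<and> (x, y) \<in> parcs (hyperdiamond_graph k)"
      by (auto simp: Q_def hyperdiamond_graph_def cayley_graph_def)
  qed (rule K.arcs_symmetric)
  then obtain \<phi> where Q: "\<forall>v\<in>pverts G. Q v (\<phi> v)"
    and arcs: "\<forall>(u, v)\<in>parcs G. (\<phi> u, \<phi> v) \<in> parcs (hyperdiamond_graph k)" by blast
  show ?thesis
  proof (rule injective_hom_imp_subgraph_iso[OF _ _ _ _ arcs])
    show "inj_on \<phi> (pverts G)"
    proof (rule inj_onI)
      fix u v assume uv: "u \<in> pverts G" "v \<in> pverts G" "\<phi> u = \<phi> v"
      then have "g u = g v" using Q[unfolded Q_def] by metis
      then show "u = v" using uv inj by (simp add: g_def inj_on_eq_iff)
    qed
    show "\<phi> ` pverts G \<subseteq> pverts (hyperdiamond_graph k)"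
      using Q by (auto simp: Q_def hyperdiamond_graph_def cayley_graph_def)
  qed unfold_locales
qed

end
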